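(* Let $X$ be a nonempty set, let $d\in\mathbb{N}$, let $\mathbf{K}:X\times X\to\mathbb{R}^{d\times d}$ be an admissible multi-task kernel, let $\mathbf{x}=\{x_j:j\in\mathbb{N}_m\}\subseteq X$ be a set of $m\in\mathbb{N}$ pairwise distinct points, and let $\beta_m\ge1$. Assume that for every $\boldsymbol{y}\in\mathbb{R}^{md}$ the problem $\min_{f\in\mathcal{I}_{\mathbf{x}}(\boldsymbol{y})}\|f\|_{\mathcal{B}_{\mathbf{K}}}$ has a minimizer. Then $$\min_{f\in\mathcal{I}_{\mathbf{x}}(\boldsymbol{y})}\|f\|_{\mathcal{B}_{\mathbf{K}}}\ge\frac1{\beta_m}\min_{f\in\mathcal{I}_{\mathbf{x}}(\boldsymbol{y})\cap\mathcal{S}^{\mathbf{x}}}\|f\|_{\mathcal{B}_{\mathbf{K}}}\quad\text{for all }\boldsymbol{y}\in\mathbb{R}^{md}$$ if and only if $$\sup_{t\in X}\|\mathbf{K}[\mathbf{x}]^{-1}\mathbf{K}_{\mathbf{x}}(t)\|_1\le\beta_m.$$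
   Context: $\mathbb{N}=\{1,2,\dots\}$ and $\mathbb{N}_m=\{1,\dots,m\}$. For a vector, $\|\cdot\|_p$ is the $\ell^p$ norm; for a matrix, $\|\cdot\|_p$ is the $\ell^p$-induced operator norm. For a nonempty set $\Omega$, $\ell^1_d(\Omega)=\{\boldsymbol{c}=(\boldsymbol{c}_t\in\mathbb{R}^d:t\in\Omega): \|\boldsymbol{c}\|_{\ell^1_d(\Omega)}=\sum_{t\in\Omega}\|\boldsymbol{c}_t\|_1<\infty\}$, and $\mathrm{supp}\,\boldsymbol{c}=\{t:\boldsymbol{c}_t\ne0\}$. For points $\mathbf{x}=\{x_1,\dots,x_m\}$, $\mathbf{K}[\mathbf{x}]\in\mathbb{R}^{md\times md}$ is the block matrix whose $(j,k)$ block is $\mathbf{K}(x_k,x_j)$, and for $t\in X$, $\mathbf{K}_{\mathbf{x}}(t)=(\mathbf{K}(t,x_j):j\in\mathbb{N}_m)^\top\in\mathbb{R}^{md\times d}$ is the block column whose $j$-th block is $\mathbf{K}(t,x_j)$. Admissible multi-task kernel: a function $\mathbf{K}:X\times X\to\mathbb{R}^{d\times d}$ with $\mathbf{K}(x,x')^\top=\mathbf{K}(x,x')$ for all $x,x'\in X$ such that (A1) $\mathbf{K}[\mathbf{x}]$ is non-singular for all finite sets $\mathbf{x}$ of pairwise distinct points of $X$; (A2) there is $\kappa>0$ with $\|\mathbf{K}(x,x')\|_1\le\kappa$ for all $x,x'\in X$; (A3) for all pairwise distinct $x_j\in X$, $j\in\mathbb{N}$, and $(\boldsymbol{c}_j)_{j\in\mathbb{N}}\in\ell^1_d(\mathbb{N})$,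 if $\sum_{j\in\mathbb{N}}\mathbf{K}(x_j,x)\boldsymbol{c}_j=0$ for all $x\in X$, then $\boldsymbol{c}_j=0$ for all $j$. The space $\mathcal{B}_{\mathbf{K}}=\{\sum_{x\in\mathrm{supp}\,\boldsymbol{c}}\mathbf{K}(x,\cdot)\boldsymbol{c}_x:\boldsymbol{c}\in\ell^1_d(X)\}$ carries the norm $\|\sum_{x\in\mathrm{supp}\,\boldsymbol{c}}\mathbf{K}(x,\cdot)\boldsymbol{c}_x\|_{\mathcal{B}_{\mathbf{K}}}=\|\boldsymbol{c}\|_{\ell^1_d(X)}$. For $\boldsymbol{y}=(\boldsymbol{y}_1,\dots,\boldsymbol{y}_m)\in\mathbb{R}^{md}$, $\mathcal{I}_{\mathbf{x}}(\boldsymbol{y})=\{f\in\mathcal{B}_{\mathbf{K}}: f(x_j)=\boldsymbol{y}_j,\ j\in\mathbb{N}_m\}$, and $\mathcal{S}^{\mathbf{x}}=\{\sum_{j=1}^m\mathbf{K}(x_j,\cdot)\boldsymbol{c}_j:\boldsymbol{c}_j\in\mathbb{R}^d\}$. *)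

theory Defs
  imports
    "Jordan_Normal_Form.Gauss_Jordan_Elimination"
    "HOL-Analysis.Infinite_Sum"
    "HOL-Library.Extended_Real"
begin

text \<open>
  Vectors and matrices are those of the Jordan normal form library, because the size \<open>m d\<close> of
  the block matrices varies inside the definition of admissibility. Indices therefore start at 0, and a finite family
  of points \<open>x\<^sub>1, \<dots>, x\<^sub>m\<close> is a list.
\<close>

definition l1_norm :: "real vec \<Rightarrow> real" where
  "l1_norm v = (\<Sum>i<dim_vec v. \<bar>v $ i\<bar>)"

text \<open>The same shape as the library's \<open>onorm\<close>; the vector \<open>v = 0\<close> contributes \<open>0 / 0 = 0\<close>.\<close>

definition op_norm1 :: "real mat \<Rightarrow> real" where
  "op_norm1 A = (SUP v\<in>carrier_vec (dim_col A). l1_norm (A *\<^sub>v v) / l1_norm v)"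

text \<open>
  Families indexed by \<open>\<Omega>\<close> are extensional functions, and so are functions on \<open>X\<close> below: equality
  of such functions is equality on the index set or domain.
\<close>

definition ell1 :: "nat \<Rightarrow> 'i set \<Rightarrow> ('i \<Rightarrow> real vec) set" where
  "ell1 d \<Omega> = {c \<in> \<Omega> \<rightarrow>\<^sub>E carrier_vec d. (\<lambda>t. l1_norm (c t)) summable_on \<Omega>}"

definition ell1_norm :: "'i set \<Rightarrow> ('i \<Rightarrow> real vec) \<Rightarrow> real" where
  "ell1_norm \<Omega> c = (\<Sum>\<^sub>\<infinity>t\<in>\<Omega>. l1_norm (c t))"

definition supp :: "nat \<Rightarrow> 'i set \<Rightarrow> ('i \<Rightarrow> real vec) \<Rightarrow> 'i set" where
  "supp d \<Omega> c = {t \<in> \<Omega>. c t \<noteq> 0\<^sub>v d}"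

text \<open>
  Type \<^typ>\<open>real vec\<close> has no topology, so series in \<open>\<real>\<^sup>d\<close> are summed coordinatewise. In all uses
  below with an infinite index set, boundedness of \<open>K\<close> makes the series absolutely convergent.
\<close>

definition vec_infsum :: "nat \<Rightarrow> ('i \<Rightarrow> real vec) \<Rightarrow> 'i set \<Rightarrow> real vec" where
  "vec_infsum d f I = vec d (\<lambda>i. \<Sum>\<^sub>\<infinity>t\<in>I. f t $ i)"

text \<open>\<open>K[x]\<close>: the block in block row \<open>j\<close> and block column \<open>k\<close> is \<open>K(x\<^sub>k, x\<^sub>j)\<close>.\<close>

definition kernel_mat :: "nat \<Rightarrow> ('a \<Rightarrow> 'a \<Rightarrow> real mat) \<Rightarrow> 'a list \<Rightarrow> real mat" where
  "kernel_mat d K xs = mat (length xs * d) (length xs * d)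
     (\<lambda>(r, s). K (xs ! (s div d)) (xs ! (r div d)) $$ (r mod d, s mod d))"

definition kernel_col :: "nat \<Rightarrow> ('a \<Rightarrow> 'a \<Rightarrow> real mat) \<Rightarrow> 'a list \<Rightarrow> 'a \<Rightarrow> real mat" where
  "kernel_col d K xs t = mat (length xs * d) d
     (\<lambda>(r, s). K t (xs ! (r div d)) $$ (r mod d, s))"

definition admissible_kernel :: "nat \<Rightarrow> 'a set \<Rightarrow> ('a \<Rightarrow> 'a \<Rightarrow> real mat) \<Rightarrow> bool" where
  "admissible_kernel d X K \<longleftrightarrow>
     (\<forall>x\<in>X. \<forall>x'\<in>X. K x x' \<in> carrier_mat d d \<and> transpose_mat (K x x') = K x x') \<and>
     (\<forall>xs. set xs \<subseteq> X \<and> distinct xs \<longrightarrow> invertible_mat (kernel_mat d K xs)) \<and>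
     (\<exists>\<kappa>>0. \<forall>x\<in>X. \<forall>x'\<in>X. op_norm1 (K x x') \<le> \<kappa>) \<and>
     (\<forall>(p :: nat \<Rightarrow> 'a) c. inj p \<and> range p \<subseteq> X \<and> c \<in> ell1 d UNIV \<and>
        (\<forall>x\<in>X. vec_infsum d (\<lambda>j. K (p j) x *\<^sub>v c j) UNIV = 0\<^sub>v d) \<longrightarrow>
        (\<forall>j. c j = 0\<^sub>v d))"

definition kernel_sum ::
  "nat \<Rightarrow> 'a set \<Rightarrow> ('a \<Rightarrow> 'a \<Rightarrow> real mat) \<Rightarrow> ('a \<Rightarrow> real vec) \<Rightarrow> 'a \<Rightarrow> real vec" where
  "kernel_sum d X K c = (\<lambda>s\<in>X. vec_infsum d (\<lambda>x. K x s *\<^sub>v c x) (supp d X c))"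

definition B_space :: "nat \<Rightarrow> 'a set \<Rightarrow> ('a \<Rightarrow> 'a \<Rightarrow> real mat) \<Rightarrow> ('a \<Rightarrow> real vec) set" where
  "B_space d X K = kernel_sum d X K ` ell1 d X"

text \<open>Well defined on \<open>B_space\<close>: for admissible \<open>K\<close> an element has only one coefficient family.\<close>

definition B_norm :: "nat \<Rightarrow> 'a set \<Rightarrow> ('a \<Rightarrow> 'a \<Rightarrow> real mat) \<Rightarrow> ('a \<Rightarrow> real vec) \<Rightarrow> real" where
  "B_norm d X K f = (THE r. \<exists>c\<in>ell1 d X. f = kernel_sum d X K c \<and> r = ell1_norm X c)"

definition interpolants ::
  "nat \<Rightarrow> 'a set \<Rightarrow> ('a \<Rightarrow> 'a \<Rightarrow> real mat) \<Rightarrow> 'a list \<Rightarrow> real vec \<Rightarrow> ('a \<Rightarrow> real vec) set" where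
  "interpolants d X K xs y =
     {f \<in> B_space d X K. \<forall>j<length xs. f (xs ! j) = vec d (\<lambda>i. y $ (j * d + i))}"

definition S_space ::
  "nat \<Rightarrow> 'a set \<Rightarrow> ('a \<Rightarrow> 'a \<Rightarrow> real mat) \<Rightarrow> 'a list \<Rightarrow> ('a \<Rightarrow> real vec) set" where
  "S_space d X K xs =
     {(\<lambda>s\<in>X. vec_infsum d (\<lambda>j. K (xs ! j) s *\<^sub>v c j) {..<length xs}) | c.
        \<forall>j<length xs. c j \<in> carrier_vec d}"

text \<open>
  A genuine minimum, not an infimum. Over \<open>interpolants \<inter> S_space\<close> it is always attained for
  admissible \<open>K\<close>: non-singularity of \<open>K[x]\<close> makes that set a singleton.
\<close>

definition min_B_norm ::
  "nat \<Rightarrow> 'a set \<Rightarrow> ('a \<Rightarrow> 'a \<Rightarrow> real mat) \<Rightarrow> ('a \<Rightarrow> real vec) set \<Rightarrow> real" where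
  "min_B_norm d X K F = (LEAST r. r \<in> B_norm d X K ` F)"

end

theory Submission
  imports Defs
begin

text \<open>
  Write \<open>B = K[x]\<^sup>-\<^sup>1\<close>. The only interpolant of \<open>y\<close> in \<open>S\<^sup>x\<close> has coefficient vector \<open>B y\<close>, hence norm
  \<open>\<parallel>B y\<parallel>\<^sub>1\<close>. If the minima satisfy the inequality, test it on \<open>y = K\<^sub>x(t) v\<close>, which \<open>K(t, \<cdot>) v\<close>
  interpolates with norm \<open>\<parallel>v\<parallel>\<^sub>1\<close>: this gives \<open>\<parallel>B K\<^sub>x(t) v\<parallel>\<^sub>1 \<le> \<beta> \<parallel>v\<parallel>\<^sub>1\<close>. Conversely, a minimizer with
  coefficients \<open>c\<close> gives \<open>B y = \<Sum>\<^sub>t B K\<^sub>x(t) c\<^sub>t\<close>, whose norm is at most \<open>\<beta> \<Sum>\<^sub>t \<parallel>c\<^sub>t\<parallel>\<^sub>1\<close>.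
  Uniqueness of the coefficients, on which the norm depends, comes from (A3) when \<open>X\<close> is infinite,
  after enlarging the countable support to an infinite countable set; when \<open>X\<close> is finite, (A3) is
  vacuous and (A1) is used instead.
\<close>

section \<open>The l1 norm and its induced operator norm\<close>

lemma l1_norm_nonneg: "0 \<le> l1_norm v"
  by (simp add: l1_norm_def sum_nonneg)

lemma abs_index_le_l1_norm: "i < dim_vec v \<Longrightarrow> \<bar>v $ i\<bar> \<le> l1_norm v"
  unfolding l1_norm_def by (rule member_le_sum) auto

lemma l1_norm_zero: "l1_norm (0\<^sub>v n) = 0"
  by (simp add: l1_norm_def)

lemma l1_norm_eq_0_iff:
  assumes "v \<in> carrier_vec n"
  shows "l1_norm v = 0 \<longleftrightarrow> v = 0\<^sub>v n"
proof
  assume "l1_norm v = 0"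
  then have "\<forall>i<n. v $ i = 0"
    using assms abs_index_le_l1_norm[of _ v] by fastforce
  then show "v = 0\<^sub>v n" using assms by auto
qed (simp add: l1_norm_zero)

lemma l1_norm_diff_le:
  assumes "v \<in> carrier_vec n" "w \<in> carrier_vec n"
  shows "l1_norm (v - w) \<le> l1_norm v + l1_norm w"
proof -
  have "l1_norm (v - w) \<le> (\<Sum>i<n. \<bar>v $ i\<bar> + \<bar>w $ i\<bar>)"
    unfolding l1_norm_def using assms by (auto intro!: sum_mono)
  then show ?thesis
    using assms by (auto simp: l1_norm_def sum.distrib)
qed

lemma mult_mat_vec_index_sum:
  fixes A :: "real mat"
  assumes "A \<in> carrier_mat n k" "v \<in> carrier_vec k" "i < n"
  shows "(A *\<^sub>v v) $ i = (\<Sum>j<k. A $$ (i, j) * v $ j)"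
  using assms by (simp add: scalar_prod_def atLeast0LessThan)

text \<open>The constant is crude; only its finiteness matters, since it bounds the quotients in
  \<open>op_norm1\<close> and so makes their real supremum meaningful.\<close>

lemma l1_norm_mult_mat_vec_le:
  assumes "A \<in> carrier_mat n k" "v \<in> carrier_vec k"
  shows "l1_norm (A *\<^sub>v v) \<le> (\<Sum>i<n. \<Sum>j<k. \<bar>A $$ (i, j)\<bar>) * l1_norm v"
proof -
  have "\<bar>(A *\<^sub>v v) $ i\<bar> \<le> (\<Sum>j<k. \<bar>A $$ (i, j)\<bar>) * l1_norm v" if "i < n" for i
  proof -
    have "(A *\<^sub>v v) $ i = (\<Sum>j<k. A $$ (i, j) * v $ j)"
      using assms that by (rule mult_mat_vec_index_sum)
    then have "\<bar>(A *\<^sub>v v) $ i\<bar> \<le> (\<Sum>j<k. \<bar>A $$ (i, j) * v $ j\<bar>)"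
      by simp
    also have "\<dots> \<le> (\<Sum>j<k. \<bar>A $$ (i, j)\<bar> * l1_norm v)"
      using assms abs_index_le_l1_norm[of _ v]
      by (intro sum_mono) (auto simp: abs_mult intro!: mult_left_mono)
    finally show ?thesis by (simp add: sum_distrib_right)
  qed
  then show ?thesis
    using assms by (auto simp: l1_norm_def sum_distrib_right intro!: sum_mono)
qed

text \<open>Removes the division from \<open>op_norm1\<close>. Nonnegativity of \<open>b\<close>
  accounts for the zero vector, whose quotient is 0 / 0 = 0.\<close>

lemma op_norm1_le_iff:
  assumes "A \<in> carrier_mat n k" "0 \<le> b"
  shows "op_norm1 A \<le> b \<longleftrightarrow> (\<forall>v\<in>carrier_vec k. l1_norm (A *\<^sub>v v) \<le> b * l1_norm v)"
proof -
  have quot_le: "l1_norm (A *\<^sub>v v) / l1_norm v \<le> r \<longleftrightarrow> l1_norm (A *\<^sub>v v) \<le> r * l1_norm v"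
    if "v \<in> carrier_vec k" "0 \<le> r" for v r
  proof (cases "l1_norm v = 0")
    case True
    then have "v = 0\<^sub>v k" using that l1_norm_eq_0_iff by blast
    then have "A *\<^sub>v v = 0\<^sub>v n" using assms by auto
    then show ?thesis using True that by (simp add: l1_norm_zero)
  next
    case False
    then have "0 < l1_norm v" using l1_norm_nonneg[of v] by simp
    then show ?thesis by (simp add: field_simps)
  qed
  have "bdd_above ((\<lambda>v. l1_norm (A *\<^sub>v v) / l1_norm v) ` carrier_vec k)"
    using l1_norm_mult_mat_vec_le[OF assms(1)] quot_le
    by (intro bdd_aboveI2[where M = "\<Sum>i<n. \<Sum>j<k. \<bar>A $$ (i, j)\<bar>"]) (simp add: sum_nonneg)
  moreover have "carrier_vec k \<noteq> ({} :: real vec set)" using zero_carrier_vec by blast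
  ultimately show ?thesis
    using assms quot_le by (simp add: op_norm1_def cSUP_le_iff)
qed

lemma mult_mat_vec_zero:
  fixes A :: "real mat"
  shows "A \<in> carrier_mat n k \<Longrightarrow> A *\<^sub>v 0\<^sub>v k = 0\<^sub>v n"
  by auto

section \<open>Splitting vectors of length \<open>m * d\<close> into blocks\<close>

lemma sum_blocks:
  fixes f :: "nat \<Rightarrow> 'b::comm_monoid_add"
  shows "(\<Sum>r<m * d. f r) = (\<Sum>j<m. \<Sum>i<d. f (j * d + i))"
proof -
  have "sum f {j * d..<j * d + d} = (\<Sum>i<d. f (j * d + i))" for j
    by (subst sum.atLeastLessThan_shift_0) (simp add: atLeast0LessThan)
  then show ?thesis by (simp only: sum.nat_group[symmetric])
qed

lemma block_index_less:
  fixes m :: nat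
  assumes "j < m" "i < d"
  shows "j * d + i < m * d"
proof -
  have "j * d + i < Suc j * d" using assms by simp
  also have "\<dots> \<le> m * d" using assms by (intro mult_le_mono1) simp
  finally show ?thesis .
qed

text \<open>This is the form in which \<open>interpolants\<close> prescribes values, so
  interpolation reads \<open>f (xs ! j) = block d y j\<close>.\<close>

definition block :: "nat \<Rightarrow> 'b vec \<Rightarrow> nat \<Rightarrow> 'b vec" where
  "block d w j = vec d (\<lambda>i. w $ (j * d + i))"

lemma block_carrier: "block d w j \<in> carrier_vec d"
  by (simp add: block_def)

lemma block_zero: "j < m \<Longrightarrow> block d (0\<^sub>v (m * d)) j = 0\<^sub>v d"
  by (intro eq_vecI) (auto simp: block_def block_index_less)

lemma block_eqI:
  assumes "v \<in> carrier_vec (m * d)" "w \<in> carrier_vec (m * d)"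
    and "\<And>j. j < m \<Longrightarrow> block d v j = block d w j"
  shows "v = w"
proof (rule eq_vecI)
  fix r assume "r < dim_vec w"
  then have r: "r < m * d" using assms by simp
  \<comment> \<open>An index below \<open>m * d\<close> exists, which excludes d = 0 and makes
    division by \<open>d\<close> with remainder available.\<close>
  then have "0 < d" by (cases d) auto
  then have "r mod d < d" "r div d < m" using r by (auto simp: less_mult_imp_div_less)
  then show "v $ r = w $ r"
    using arg_cong[OF assms(3)[of "r div d"], of "\<lambda>u. u $ (r mod d)"] by (simp add: block_def)
qed (use assms in auto)

lemma l1_norm_blocks:
  "w \<in> carrier_vec (m * d) \<Longrightarrow> l1_norm w = (\<Sum>j<m. l1_norm (block d w j))"
  by (simp add: l1_norm_def sum_blocks block_def)

text \<open>A right inverse of \<open>block d\<close>: it stacks coefficient vectors so that the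
  kernel matrix can act on them.\<close>

definition concat_blocks :: "nat \<Rightarrow> nat \<Rightarrow> (nat \<Rightarrow> 'b vec) \<Rightarrow> 'b vec" where
  "concat_blocks d m c = vec (m * d) (\<lambda>r. c (r div d) $ (r mod d))"

lemma concat_blocks_carrier: "concat_blocks d m c \<in> carrier_vec (m * d)"
  by (simp add: concat_blocks_def)

lemma block_concat_blocks:
  "j < m \<Longrightarrow> c j \<in> carrier_vec d \<Longrightarrow> block d (concat_blocks d m c) j = c j"
  by (intro eq_vecI) (auto simp: block_def concat_blocks_def block_index_less)

section \<open>Interchange of finite sums with infinite series\<close>

lemma has_sum_finite_sum:
  fixes f :: "'i \<Rightarrow> 'j \<Rightarrow> real"
  assumes "finite I" "\<And>i. i \<in> I \<Longrightarrow> (f i has_sum s i) A"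
  shows "((\<lambda>x. \<Sum>i\<in>I. f i x) has_sum (\<Sum>i\<in>I. s i)) A"
  using assms by (induction I rule: finite_induct) (auto intro!: has_sum_add)

lemma summable_on_finite_sum:
  fixes f :: "'i \<Rightarrow> 'j \<Rightarrow> real"
  assumes "finite I" "\<And>i. i \<in> I \<Longrightarrow> f i summable_on A"
  shows "(\<lambda>x. \<Sum>i\<in>I. f i x) summable_on A"
  using assms by (induction I rule: finite_induct) (auto intro!: summable_on_add)

lemma infsum_finite_sum:
  fixes f :: "'i \<Rightarrow> 'j \<Rightarrow> real"
  assumes "finite I" "\<And>i. i \<in> I \<Longrightarrow> f i summable_on A"
  shows "(\<Sum>\<^sub>\<infinity>x\<in>A. \<Sum>i\<in>I. f i x) = (\<Sum>i\<in>I. \<Sum>\<^sub>\<infinity>x\<in>A. f i x)"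
  using assms by (intro infsumI has_sum_finite_sum) auto

section \<open>Block kernel matrices acting on vectors\<close>

lemma kernel_mat_carrier: "kernel_mat d K xs \<in> carrier_mat (length xs * d) (length xs * d)"
  by (simp add: kernel_mat_def)

lemma kernel_col_carrier: "kernel_col d K xs t \<in> carrier_mat (length xs * d) d"
  by (simp add: kernel_col_def)

lemma block_kernel_col_mult:
  assumes "K t (xs ! j) \<in> carrier_mat d d" "v \<in> carrier_vec d" "j < length xs"
  shows "block d (kernel_col d K xs t *\<^sub>v v) j = K t (xs ! j) *\<^sub>v v"
  using assms
  by (intro eq_vecI)
    (auto simp: block_def kernel_col_def block_index_less mult_mat_vec_index_sum scalar_prod_def)

text \<open>Splitting the column index into block and offset turns one row product into a sum of
  block products.\<close>

lemma block_kernel_mat_mult_index: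
  assumes "\<And>k. k < length xs \<Longrightarrow> K (xs ! k) (xs ! j) \<in> carrier_mat d d"
    and "w \<in> carrier_vec (length xs * d)" "j < length xs" "i < d"
  shows "block d (kernel_mat d K xs *\<^sub>v w) j $ i =
    (\<Sum>k<length xs. (K (xs ! k) (xs ! j) *\<^sub>v block d w k) $ i)"
proof -
  have "block d (kernel_mat d K xs *\<^sub>v w) j $ i =
      (\<Sum>s<length xs * d. K (xs ! (s div d)) (xs ! j) $$ (i, s mod d) * w $ s)"
    using assms
    by (simp add: block_def mult_mat_vec_index_sum[OF kernel_mat_carrier] block_index_less)
      (simp add: kernel_mat_def block_index_less)
  also have "\<dots> = (\<Sum>k<length xs. \<Sum>l<d. K (xs ! k) (xs ! j) $$ (i, l) * w $ (k * d + l))"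
    using assms(4) by (simp add: sum_blocks)
  also have "\<dots> = (\<Sum>k<length xs. (K (xs ! k) (xs ! j) *\<^sub>v block d w k) $ i)"
    using assms
    by (intro sum.cong refl) (simp add: mult_mat_vec_index_sum[of _ d d] block_carrier, simp add: block_def)
  finally show ?thesis .
qed

section \<open>Summable coefficient families and families supported on a finite list\<close>

lemma ell1_carrier: "c \<in> ell1 d \<Omega> \<Longrightarrow> t \<in> \<Omega> \<Longrightarrow> c t \<in> carrier_vec d"
  by (auto simp: ell1_def)

lemma ell1_summable: "c \<in> ell1 d \<Omega> \<Longrightarrow> (\<lambda>t. l1_norm (c t)) summable_on \<Omega>"
  by (simp add: ell1_def)

lemma ell1_diff:
  assumes "c \<in> ell1 d \<Omega>" "c' \<in> ell1 d \<Omega>"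
  shows "(\<lambda>t\<in>\<Omega>. c t - c' t) \<in> ell1 d \<Omega>"
proof -
  have "l1_norm (c t - c' t) \<le> l1_norm (c t) + l1_norm (c' t)" if "t \<in> \<Omega>" for t
    using assms[THEN ell1_carrier, OF that] by (rule l1_norm_diff_le)
  then have "(\<lambda>t. l1_norm (c t - c' t)) summable_on \<Omega>"
    using summable_on_add[OF assms[THEN ell1_summable]] l1_norm_nonneg
    by (blast intro: summable_on_comparison_test)
  then have "(\<lambda>t. l1_norm ((\<lambda>t\<in>\<Omega>. c t - c' t) t)) summable_on \<Omega>"
    by (rule summable_on_cong[THEN iffD1, rotated]) simp
  then show ?thesis
    using assms by (auto simp: ell1_def intro!: minus_carrier_vec)
qed

text \<open>The family on \<open>X\<close> carrying the coefficient \<open>c j\<close> at the \<open>j\<close>-th point of \<open>xs\<close>.\<close>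

definition point_family ::
  "nat \<Rightarrow> 'a set \<Rightarrow> 'a list \<Rightarrow> (nat \<Rightarrow> real vec) \<Rightarrow> 'a \<Rightarrow> real vec" where
  "point_family d X xs c =
     (\<lambda>t\<in>X. if t \<in> set xs then c (the_inv_into {..<length xs} ((!) xs) t) else 0\<^sub>v d)"

lemma point_family_nth:
  assumes "distinct xs" "set xs \<subseteq> X" "j < length xs"
  shows "point_family d X xs c (xs ! j) = c j"
proof -
  have "the_inv_into {..<length xs} ((!) xs) (xs ! j) = j"
    using assms by (intro the_inv_into_f_f inj_on_nth) auto
  moreover have "xs ! j \<in> set xs" "xs ! j \<in> X" using assms by auto
  ultimately show ?thesis using assms by (auto simp: point_family_def)
qed

lemma point_family_outside: "t \<in> X - set xs \<Longrightarrow> point_family d X xs c t = 0\<^sub>v d"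
  by (simp add: point_family_def)

text \<open>Only the points of \<open>xs\<close> contribute, because \<open>g t\<close> vanishes at
  the zero vector. An arbitrary \<open>g\<close> covers both the norm series and the coordinates of
  the kernel series.\<close>

lemma point_family_has_sum:
  fixes g :: "'a \<Rightarrow> real vec \<Rightarrow> real"
  assumes "distinct xs" "set xs \<subseteq> X" "\<And>t. t \<in> X \<Longrightarrow> g t (0\<^sub>v d) = 0"
  shows "((\<lambda>t. g t (point_family d X xs c t)) has_sum (\<Sum>j<length xs. g (xs ! j) (c j))) X"
proof -
  have "(\<Sum>j<length xs. g (xs ! j) (c j)) =
      (\<Sum>j<length xs. g (xs ! j) (point_family d X xs c (xs ! j)))"
    using assms by (simp add: point_family_nth)
  also have "\<dots> = (\<Sum>t\<in>set xs. g t (point_family d X xs c t))"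
    using assms by (intro sum.reindex_bij_betw bij_betw_nth) auto
  finally have "((\<lambda>t. g t (point_family d X xs c t)) has_sum
      (\<Sum>j<length xs. g (xs ! j) (c j))) (set xs)"
    by simp
  then show ?thesis
    by (rule has_sum_cong_neutral[THEN iffD1, rotated -1])
      (use assms in \<open>auto simp: point_family_outside\<close>)
qed

lemma point_family_ell1:
  assumes "distinct xs" "set xs \<subseteq> X" "\<And>j. j < length xs \<Longrightarrow> c j \<in> carrier_vec d"
  shows "point_family d X xs c \<in> ell1 d X"
proof -
  have "point_family d X xs c t \<in> carrier_vec d" if "t \<in> X" for t
  proof (cases "t \<in> set xs")
    case True
    then obtain j where "j < length xs" "t = xs ! j" by (metis in_set_conv_nth)
    then show ?thesis using assms by (simp add: point_family_nth)
  next
    case False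
    then show ?thesis using that by (simp add: point_family_outside)
  qed
  moreover have "(\<lambda>t. l1_norm (point_family d X xs c t)) summable_on X"
    by (rule has_sum_imp_summable[OF point_family_has_sum])
      (use assms in \<open>auto simp: l1_norm_zero\<close>)
  moreover have "point_family d X xs c \<in> extensional X"
    by (simp add: point_family_def)
  ultimately show ?thesis by (auto simp: ell1_def PiE_def)
qed

lemma point_family_ell1_norm:
  assumes "distinct xs" "set xs \<subseteq> X"
  shows "ell1_norm X (point_family d X xs c) = (\<Sum>j<length xs. l1_norm (c j))"
  unfolding ell1_norm_def
  by (rule infsumI[OF point_family_has_sum]) (use assms in \<open>auto simp: l1_norm_zero\<close>)

section \<open>Kernel series of an admissible kernel and inversion of \<open>K[x]\<close>\<close>

locale multi_task_kernel =
  fixes d :: nat and X :: "'a set" and K :: "'a \<Rightarrow> 'a \<Rightarrow> real mat"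
  assumes admissible: "admissible_kernel d X K"
begin

lemma kernel_carrier: "x \<in> X \<Longrightarrow> x' \<in> X \<Longrightarrow> K x x' \<in> carrier_mat d d"
  using admissible by (simp add: admissible_kernel_def)

lemma kernel_bounded:
  obtains \<kappa> where "\<And>x x' v. x \<in> X \<Longrightarrow> x' \<in> X \<Longrightarrow> v \<in> carrier_vec d
    \<Longrightarrow> l1_norm (K x x' *\<^sub>v v) \<le> \<kappa> * l1_norm v"
proof -
  obtain \<kappa> where "\<kappa> > 0" "\<forall>x\<in>X. \<forall>x'\<in>X. op_norm1 (K x x') \<le> \<kappa>"
    using admissible by (auto simp: admissible_kernel_def)
  then show ?thesis
    using that[of \<kappa>] op_norm1_le_iff[OF kernel_carrier, of _ _ \<kappa>] by simp
qed

lemma kernel_mult_zero: "x \<in> X \<Longrightarrow> x' \<in> X \<Longrightarrow> K x x' *\<^sub>v 0\<^sub>v d = 0\<^sub>v d"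
  by (intro mult_mat_vec_zero kernel_carrier)

text \<open>By (A2) each coordinate is dominated by \<kappa> times \<open>l1_norm (c t)\<close>, so
  the series converges absolutely.\<close>

lemma kernel_sum_summable:
  assumes "c \<in> ell1 d X" "s \<in> X" "i < d"
  shows "(\<lambda>t. (K t s *\<^sub>v c t) $ i) summable_on X"
proof -
  obtain \<kappa> where \<kappa>: "\<And>x x' v. x \<in> X \<Longrightarrow> x' \<in> X \<Longrightarrow> v \<in> carrier_vec d
      \<Longrightarrow> l1_norm (K x x' *\<^sub>v v) \<le> \<kappa> * l1_norm v"
    using kernel_bounded by blast
  have "norm ((K t s *\<^sub>v c t) $ i) \<le> \<kappa> * l1_norm (c t)" if "t \<in> X" for t
    using abs_index_le_l1_norm[of i "K t s *\<^sub>v c t"] \<kappa>[of t s "c t"] that assms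
      kernel_carrier[of t s] ell1_carrier[of c d X t] by fastforce
  then show ?thesis
    by (rule abs_summable_summable[OF abs_summable_on_comparison_test'
        [OF summable_on_cmult_right[OF ell1_summable[OF assms(1)]]]])
qed

text \<open>Terms off the support vanish. With the index set \<open>X\<close> independent of
  \<open>c\<close>, series of different families can be subtracted termwise.\<close>

lemma kernel_sum_index:
  assumes "s \<in> X" "i < d"
  shows "kernel_sum d X K c s $ i = (\<Sum>\<^sub>\<infinity>t\<in>X. (K t s *\<^sub>v c t) $ i)"
proof -
  have "(\<Sum>\<^sub>\<infinity>t\<in>supp d X c. (K t s *\<^sub>v c t) $ i) = (\<Sum>\<^sub>\<infinity>t\<in>X. (K t s *\<^sub>v c t) $ i)"
    using assms by (intro infsum_cong_neutral) (auto simp: supp_def kernel_mult_zero)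
  then show ?thesis using assms by (simp add: kernel_sum_def vec_infsum_def)
qed

lemma kernel_sum_carrier: "s \<in> X \<Longrightarrow> kernel_sum d X K c s \<in> carrier_vec d"
  by (simp add: kernel_sum_def vec_infsum_def)

text \<open>Admissibility yields an abstract inverse, whereas \<open>mat_inverse\<close> is an
  option-valued algorithm. The result \<open>None\<close> would mean that \<open>A\<close> is not a
  unit of the matrix ring, so \<open>A\<close> is shown to be one.\<close>

lemma kernel_inverse:
  assumes "distinct xs" "set xs \<subseteq> X"
  defines "A \<equiv> kernel_mat d K xs" and "N \<equiv> length xs * d"
  defines "B \<equiv> the (mat_inverse A)"
  shows "B \<in> carrier_mat N N" "A * B = 1\<^sub>m N" "B * A = 1\<^sub>m N"
proof -
  have A: "A \<in> carrier_mat N N" by (simp add: A_def N_def kernel_mat_carrier)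
  have "invertible_mat A"
    using admissible assms by (auto simp: admissible_kernel_def)
  then obtain C where C: "A * C = 1\<^sub>m N" "C * A = 1\<^sub>m (dim_row C)"
    using A by (auto simp: invertible_mat_def inverts_mat_def)
  \<comment> \<open>\<open>invertible_mat\<close> leaves the size of \<open>C\<close> open;
    comparing column counts in both products fixes it.\<close>
  have "dim_col C = N" using arg_cong[OF C(1), of dim_col] by simp
  moreover have "dim_row C = N" using arg_cong[OF C(2), of dim_col] A by simp
  ultimately have "C \<in> carrier_mat N N" "C * A = 1\<^sub>m N" using C by auto
  then have "A \<in> Units (ring_mat TYPE(real) N ())"
    using A C(1) by (auto simp: Units_def ring_mat_def)
  then obtain B' where "mat_inverse A = Some B'"
    using mat_inverse(1)[OF A, where b = "()"] by (cases "mat_inverse A") auto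
  then show "B \<in> carrier_mat N N" "A * B = 1\<^sub>m N" "B * A = 1\<^sub>m N"
    using mat_inverse(2)[OF A] by (auto simp: B_def)
qed

lemma kernel_sum_point_family:
  assumes "distinct xs" "set xs \<subseteq> X"
  shows "kernel_sum d X K (point_family d X xs c) =
    (\<lambda>s\<in>X. vec_infsum d (\<lambda>j. K (xs ! j) s *\<^sub>v c j) {..<length xs})"
proof (rule ext)
  fix s
  show "kernel_sum d X K (point_family d X xs c) s =
    (\<lambda>s\<in>X. vec_infsum d (\<lambda>j. K (xs ! j) s *\<^sub>v c j) {..<length xs}) s"
  proof (cases "s \<in> X")
    case True
    have "kernel_sum d X K (point_family d X xs c) s $ i = (\<Sum>j<length xs. (K (xs ! j) s *\<^sub>v c j) $ i)"
      if "i < d" for i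
      unfolding kernel_sum_index[OF True that]
      by (rule infsumI[OF point_family_has_sum[where g = "\<lambda>t v. (K t s *\<^sub>v v) $ i"]])
        (use assms True that in \<open>auto simp: kernel_mult_zero\<close>)
    then show ?thesis
      using True kernel_sum_carrier[OF True] by (intro eq_vecI) (auto simp: vec_infsum_def)
  qed (simp add: kernel_sum_def)
qed

text \<open>Evaluating at \<open>xs ! j\<close> the section centred at \<open>xs ! k\<close> gives
  block (j, k) of the kernel matrix. Interpolation within \<open>S_space\<close> thus becomes a
  linear system.\<close>

lemma kernel_sum_point_family_nth:
  assumes "distinct xs" "set xs \<subseteq> X" "w \<in> carrier_vec (length xs * d)" "j < length xs"
  shows "kernel_sum d X K (point_family d X xs (block d w)) (xs ! j) =
    block d (kernel_mat d K xs *\<^sub>v w) j"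
proof -
  have X: "xs ! k \<in> X" if "k < length xs" for k using that assms by auto
  show ?thesis
    using assms X
    by (intro eq_vecI)
      (auto simp: kernel_sum_point_family vec_infsum_def block_kernel_mat_mult_index kernel_carrier
        carrier_vecD[OF block_carrier])
qed

section \<open>Uniqueness of the coefficient family\<close>

lemma kernel_sum_zero_imp:
  assumes c: "c \<in> ell1 d X" and zero: "\<And>s. s \<in> X \<Longrightarrow> kernel_sum d X K c s = 0\<^sub>v d"
    and t: "t \<in> X"
  shows "c t = 0\<^sub>v d"
proof (cases "finite X")
  case True
  then obtain xs where xs: "set xs = X" "distinct xs" using finite_distinct_list by blast
  \<comment> \<open>As \<open>xs\<close> enumerates all of \<open>X\<close>, \<open>c\<close> is the
    point family of its own values; stacking them turns the hypothesis into
    \<open>K[x] w = 0\<close>.\<close>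
  define w where "w = concat_blocks d (length xs) (\<lambda>j. c (xs ! j))"
  let ?A = "kernel_mat d K xs" and ?B = "the (mat_inverse (kernel_mat d K xs))"
  note inv = kernel_inverse[OF xs(2) equalityD1[OF xs(1)]]
  have w: "w \<in> carrier_vec (length xs * d)" by (simp add: w_def concat_blocks_carrier)
  have X: "xs ! j \<in> X" if "j < length xs" for j using that xs by auto
  have block_w: "block d w j = c (xs ! j)" if "j < length xs" for j
    unfolding w_def using that X ell1_carrier[OF c] by (intro block_concat_blocks) auto
  have "point_family d X xs (block d w) = c"
  proof (rule extensionalityI[of _ X])
    fix s assume "s \<in> X"
    then obtain j where "j < length xs" "s = xs ! j" using xs by (metis in_set_conv_nth)
    then show "point_family d X xs (block d w) s = c s"
      using xs by (simp add: point_family_nth block_w)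
  qed (use c in \<open>auto simp: point_family_def ell1_def PiE_def\<close>)
  then have "block d (?A *\<^sub>v w) j = block d (0\<^sub>v (length xs * d)) j" if "j < length xs" for j
    using kernel_sum_point_family_nth[OF xs(2) equalityD1[OF xs(1)] w that] zero[OF X[OF that]]
    by (simp add: block_zero[OF that])
  then have "?A *\<^sub>v w = 0\<^sub>v (length xs * d)"
    by (rule block_eqI[OF mult_mat_vec_carrier[OF kernel_mat_carrier w] zero_carrier_vec])
  then have "(?B * ?A) *\<^sub>v w = 0\<^sub>v (length xs * d)"
    by (simp add: assoc_mult_mat_vec[OF inv(1) kernel_mat_carrier w] mult_mat_vec_zero[OF inv(1)])
  then have "w = 0\<^sub>v (length xs * d)" using inv(3) w by simp
  moreover obtain j where "j < length xs" "t = xs ! j" using t xs by (metis in_set_conv_nth)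
  ultimately show ?thesis
    using block_w block_zero by metis
next
  case False
  have "countable {t \<in> X. l1_norm (c t) \<noteq> 0}"
    using ell1_summable[OF c] by (rule summable_countable_real)
  moreover have "{t \<in> X. l1_norm (c t) \<noteq> 0} = supp d X c"
    using l1_norm_eq_0_iff[OF ell1_carrier[OF c]] by (auto simp: supp_def)
  ultimately have count: "countable (supp d X c)" by simp
  obtain Z where Z: "countable Z" "infinite Z" "Z \<subseteq> X"
    using infinite_countable_subset'[OF False] by blast
  \<comment> \<open>\<open>Z\<close> makes \<open>Y\<close> infinite, as (A3) needs distinct points
    indexed by all naturals; inserting \<open>t\<close> lets the conclusion reach \<open>t\<close>
    even off the support.\<close>
  define Y where "Y = insert t (supp d X c \<union> Z)"
  have Y: "countable Y" "infinite Y" "Y \<subseteq> X"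
    using count Z t by (auto simp: Y_def supp_def)
  define p where "p = from_nat_into Y"
  have p: "bij_betw p UNIV Y" unfolding p_def using Y bij_betw_from_nat_into by blast
  have "c (p j) = 0\<^sub>v d" for j
  proof -
    have "(\<lambda>t. l1_norm (c t)) summable_on Y"
      using ell1_summable[OF c] Y(3) by (rule summable_on_subset)
    then have "(\<lambda>j. l1_norm (c (p j))) summable_on UNIV"
      by (rule summable_on_reindex_bij_betw[OF p, THEN iffD2])
    then have "(\<lambda>j. c (p j)) \<in> ell1 d UNIV"
      using ell1_carrier[OF c] Y(3) p by (auto simp: ell1_def bij_betw_def)
    moreover have "vec_infsum d (\<lambda>j. K (p j) x *\<^sub>v c (p j)) UNIV = 0\<^sub>v d" if x: "x \<in> X" for x
    proof (rule eq_vecI)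
      fix i assume "i < dim_vec (0\<^sub>v d :: real vec)"
      then have i: "i < d" by simp
      have "(\<Sum>\<^sub>\<infinity>j. (K (p j) x *\<^sub>v c (p j)) $ i) = (\<Sum>\<^sub>\<infinity>t\<in>Y. (K t x *\<^sub>v c t) $ i)"
        by (rule infsum_reindex_bij_betw[OF p])
      \<comment> \<open>\<open>Y\<close> contains the support, so the points of \<open>X\<close>
        outside \<open>Y\<close> contribute nothing.\<close>
      also have "\<dots> = (\<Sum>\<^sub>\<infinity>t\<in>X. (K t x *\<^sub>v c t) $ i)"
        using Y(3) x i by (intro infsum_cong_neutral) (auto simp: Y_def supp_def kernel_mult_zero)
      also have "\<dots> = 0" using kernel_sum_index[OF x i, of c] zero[OF x] i by simp
      finally show "vec_infsum d (\<lambda>j. K (p j) x *\<^sub>v c (p j)) UNIV $ i = 0\<^sub>v d $ i"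
        using i by (simp add: vec_infsum_def)
    qed (simp add: vec_infsum_def)
    moreover have "inj p" "range p \<subseteq> X" using p Y(3) by (auto simp: bij_betw_def)
    moreover have "\<forall>(p :: nat \<Rightarrow> 'a) c. inj p \<and> range p \<subseteq> X \<and> c \<in> ell1 d UNIV \<and>
        (\<forall>x\<in>X. vec_infsum d (\<lambda>j. K (p j) x *\<^sub>v c j) UNIV = 0\<^sub>v d) \<longrightarrow> (\<forall>j. c j = 0\<^sub>v d)"
      using admissible unfolding admissible_kernel_def by (elim conjE)
    ultimately show ?thesis by blast
  qed
  moreover have "t \<in> range p" using p by (auto simp: bij_betw_def Y_def)
  ultimately show ?thesis by blast
qed

text \<open>By linearity the difference of the two families represents the zero function, hence is
  zero.\<close>

lemma kernel_sum_inj: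
  assumes c: "c \<in> ell1 d X" "c' \<in> ell1 d X" and eq: "kernel_sum d X K c = kernel_sum d X K c'"
  shows "c = c'"
proof (rule extensionalityI[of _ X])
  let ?e = "\<lambda>t\<in>X. c t - c' t"
  fix t assume t: "t \<in> X"
  have "kernel_sum d X K ?e s = 0\<^sub>v d" if s: "s \<in> X" for s
  proof (rule eq_vecI)
    fix i assume "i < dim_vec (0\<^sub>v d :: real vec)"
    then have i: "i < d" by simp
    have "kernel_sum d X K ?e s $ i = (\<Sum>\<^sub>\<infinity>t\<in>X. (K t s *\<^sub>v c t) $ i - (K t s *\<^sub>v c' t) $ i)"
      unfolding kernel_sum_index[OF s i]
    proof (rule infsum_cong)
      fix t assume t: "t \<in> X"
      show "(K t s *\<^sub>v ?e t) $ i = (K t s *\<^sub>v c t) $ i - (K t s *\<^sub>v c' t) $ i"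
        using t i kernel_carrier[OF t s] c[THEN ell1_carrier, OF t]
        by (simp add: mult_minus_distrib_mat_vec)
    qed
    \<comment> \<open>Splitting needs both series to be summable, since \<open>infsum\<close> is 0
      by default otherwise.\<close>
    also have "\<dots> = kernel_sum d X K c s $ i - kernel_sum d X K c' s $ i"
      unfolding kernel_sum_index[OF s i]
      using has_sum_add[OF has_sum_infsum[OF kernel_sum_summable[OF c(1) s i]]
          has_sum_cmult_right[OF has_sum_infsum[OF kernel_sum_summable[OF c(2) s i]], of "- 1"]]
      by (intro infsumI) simp
    finally show "kernel_sum d X K ?e s $ i = 0\<^sub>v d $ i" using i eq by simp
  qed (use kernel_sum_carrier[OF s] in simp)
  then have "c t - c' t = 0\<^sub>v d"
    using kernel_sum_zero_imp[OF ell1_diff[OF c], of t] t by simp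
  then show "c t = c' t"
    using c[THEN ell1_carrier, OF t] by (auto simp: vec_eq_iff)
qed (use c in \<open>auto simp: ell1_def PiE_def\<close>)

text \<open>Injectivity leaves a single candidate for the definite description in
  \<open>B_norm\<close>.\<close>

lemma B_norm_kernel_sum:
  assumes "c \<in> ell1 d X"
  shows "B_norm d X K (kernel_sum d X K c) = ell1_norm X c"
  unfolding B_norm_def
proof (rule the_equality)
  fix r assume "\<exists>c'\<in>ell1 d X. kernel_sum d X K c = kernel_sum d X K c' \<and> r = ell1_norm X c'"
  then show "r = ell1_norm X c" using kernel_sum_inj[OF assms] by auto
qed (use assms in blast)

section \<open>The unique interpolant in \<open>S_space\<close> and its norm\<close>

lemma interpolants_Int_S_space:
  assumes xs: "distinct xs" "set xs \<subseteq> X" and y: "y \<in> carrier_vec (length xs * d)"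
  defines "w \<equiv> the (mat_inverse (kernel_mat d K xs)) *\<^sub>v y"
  shows "interpolants d X K xs y \<inter> S_space d X K xs =
    {kernel_sum d X K (point_family d X xs (block d w))}"
proof -
  let ?A = "kernel_mat d K xs" and ?B = "the (mat_inverse (kernel_mat d K xs))"
  let ?N = "length xs * d"
  note inv = kernel_inverse[OF xs]
  have w: "w \<in> carrier_vec ?N" using inv(1) y by (auto simp: w_def)
  have "?A *\<^sub>v w = y"
    using assoc_mult_mat_vec[OF kernel_mat_carrier[of d K xs] inv(1) y] inv(2) y by (simp add: w_def)
  then have "\<forall>j<length xs. kernel_sum d X K (point_family d X xs (block d w)) (xs ! j) = block d y j"
    using kernel_sum_point_family_nth[OF xs w] by simp
  moreover have "point_family d X xs (block d w) \<in> ell1 d X"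
    by (rule point_family_ell1[OF xs block_carrier])
  ultimately have "kernel_sum d X K (point_family d X xs (block d w)) \<in> interpolants d X K xs y"
    unfolding interpolants_def B_space_def block_def by blast
  moreover have "kernel_sum d X K (point_family d X xs (block d w)) \<in> S_space d X K xs"
    using block_carrier[of d w] unfolding kernel_sum_point_family[OF xs] S_space_def by blast
  moreover have "f = kernel_sum d X K (point_family d X xs (block d w))"
    if f: "f \<in> interpolants d X K xs y" "f \<in> S_space d X K xs" for f
  proof -
    obtain c where c: "\<And>j. j < length xs \<Longrightarrow> c j \<in> carrier_vec d"
      and fc: "f = kernel_sum d X K (point_family d X xs c)"
      using f(2) kernel_sum_point_family[OF xs] by (auto simp: S_space_def)
    \<comment> \<open>Interpolation says that the stacked coefficients \<open>u\<close> solve the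
      system solved by \<open>w\<close>.\<close>
    define u where "u = concat_blocks d (length xs) c"
    have u: "u \<in> carrier_vec ?N" by (simp add: u_def concat_blocks_carrier)
    have "block d u j = c j" if "j < length xs" for j
      unfolding u_def using that c by (intro block_concat_blocks)
    \<comment> \<open>\<open>point_family\<close> reads only indices below \<open>length xs\<close>,
      so agreement there suffices.\<close>
    then have "point_family d X xs (block d u) = point_family d X xs c"
      using xs by (intro extensionalityI[of _ X])
        (auto simp: point_family_def in_set_conv_nth the_inv_into_f_f inj_on_nth)
    then have fu: "f = kernel_sum d X K (point_family d X xs (block d u))" using fc by simp
    have "block d (?A *\<^sub>v u) j = block d y j" if "j < length xs" for j
      using f(1) kernel_sum_point_family_nth[OF xs u that] that
      unfolding fu interpolants_def block_def by simp
    then have "?A *\<^sub>v u = y"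
      by (rule block_eqI[OF mult_mat_vec_carrier[OF kernel_mat_carrier u] y])
    then have "u = w"
      using assoc_mult_mat_vec[OF inv(1) kernel_mat_carrier[of d K xs] u] inv(3) u by (simp add: w_def)
    then show ?thesis using fu by simp
  qed
  ultimately show ?thesis by blast
qed

text \<open>The constraint set is a singleton, and the norms of the coefficient blocks add up to
  that of the stacked vector.\<close>

lemma min_B_norm_S_space:
  assumes xs: "distinct xs" "set xs \<subseteq> X" and y: "y \<in> carrier_vec (length xs * d)"
  shows "min_B_norm d X K (interpolants d X K xs y \<inter> S_space d X K xs) =
    l1_norm (the (mat_inverse (kernel_mat d K xs)) *\<^sub>v y)"
proof -
  let ?w = "the (mat_inverse (kernel_mat d K xs)) *\<^sub>v y"
  have w: "?w \<in> carrier_vec (length xs * d)"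
    using kernel_inverse(1)[OF xs] y by (rule mult_mat_vec_carrier)
  have "B_norm d X K (kernel_sum d X K (point_family d X xs (block d ?w))) = l1_norm ?w"
    using B_norm_kernel_sum[OF point_family_ell1[OF xs block_carrier]]
    unfolding point_family_ell1_norm[OF xs] l1_norm_blocks[OF w] .
  then show ?thesis
    unfolding min_B_norm_def interpolants_Int_S_space[OF xs y] by (intro Least_equality) simp_all
qed

section \<open>Bounding the inverse matrix on data interpolated by a kernel series\<close>

lemma l1_norm_inverse_interpolated_le:
  assumes xs: "distinct xs" "set xs \<subseteq> X" and y: "y \<in> carrier_vec (length xs * d)"
    and c: "c \<in> ell1 d X" and f: "kernel_sum d X K c \<in> interpolants d X K xs y"
  defines "B \<equiv> the (mat_inverse (kernel_mat d K xs))"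
  assumes bound: "\<And>t v. t \<in> X \<Longrightarrow> v \<in> carrier_vec d
    \<Longrightarrow> l1_norm (B * kernel_col d K xs t *\<^sub>v v) \<le> \<beta> * l1_norm v"
  shows "l1_norm (B *\<^sub>v y) \<le> \<beta> * ell1_norm X c"
proof -
  let ?N = "length xs * d"
  let ?C = "\<lambda>t. kernel_col d K xs t"
  \<comment> \<open>Coordinate \<open>i\<close> of the contribution of the point \<open>t\<close> to
    \<open>B y\<close>.\<close>
  define g where "g i t = (B * ?C t *\<^sub>v c t) $ i" for i t
  have B: "B \<in> carrier_mat ?N ?N" unfolding B_def by (rule kernel_inverse(1)[OF xs])
  have X: "xs ! j \<in> X" if "j < length xs" for j using that xs by auto
  note cc = ell1_carrier[OF c]
  have col_index: "(?C t *\<^sub>v c t) $ r = (K t (xs ! (r div d)) *\<^sub>v c t) $ (r mod d)"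
    if "r < ?N" "t \<in> X" for r t
  proof -
    have "0 < d" using that by (cases d) auto
    then have rd: "r div d < length xs" "r mod d < d"
      using that by (auto simp: less_mult_imp_div_less)
    show "(?C t *\<^sub>v c t) $ r = (K t (xs ! (r div d)) *\<^sub>v c t) $ (r mod d)"
      using block_kernel_col_mult[of K t xs "r div d", OF kernel_carrier[OF that(2) X[OF rd(1)]] cc[OF that(2)] rd(1)]
        rd(2) by (metis block_def div_mult_mod_eq index_vec)
  qed
  \<comment> \<open>Entry \<open>r\<close> of \<open>y\<close> is coordinate \<open>r mod d\<close>
    of the value prescribed at point \<open>r div d\<close>, which the kernel series
    attains.\<close>
  have col: "((\<lambda>t. (?C t *\<^sub>v c t) $ r) has_sum y $ r) X" if r: "r < ?N" for r
  proof -
    have "0 < d" using r by (cases d) auto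
    then have rd: "r div d < length xs" "r mod d < d"
      using r by (auto simp: less_mult_imp_div_less)
    have "kernel_sum d X K c (xs ! (r div d)) $ (r mod d) = y $ r"
      using f rd by (simp add: interpolants_def)
    then have "((\<lambda>t. (K t (xs ! (r div d)) *\<^sub>v c t) $ (r mod d)) has_sum y $ r) X"
      using has_sum_infsum[OF kernel_sum_summable[OF c X[OF rd(1)] rd(2)]]
      by (simp add: kernel_sum_index[OF X[OF rd(1)] rd(2)])
    then show ?thesis
      by (rule has_sum_cong[THEN iffD2, rotated]) (simp add: col_index r)
  qed
  \<comment> \<open>A row of \<open>B\<close> forms a finite combination, so it passes through the
    convergent series termwise.\<close>
  have g_sum: "(g i has_sum (B *\<^sub>v y) $ i) X" if i: "i < ?N" for i
  proof -
    have "((\<lambda>t. \<Sum>r<?N. B $$ (i, r) * (?C t *\<^sub>v c t) $ r) has_sum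
        (\<Sum>r<?N. B $$ (i, r) * y $ r)) X"
      by (intro has_sum_finite_sum has_sum_cmult_right col) auto
    moreover have "g i t = (\<Sum>r<?N. B $$ (i, r) * (?C t *\<^sub>v c t) $ r)" if "t \<in> X" for t
      unfolding g_def assoc_mult_mat_vec[OF B kernel_col_carrier cc[OF that]]
      using kernel_col_carrier[of d K xs t] cc[OF that] by (intro mult_mat_vec_index_sum[OF B _ i]) auto
    ultimately show ?thesis
      unfolding mult_mat_vec_index_sum[OF B y i]
      by (subst has_sum_cong[where g = "\<lambda>t. \<Sum>r<?N. B $$ (i, r) * (?C t *\<^sub>v c t) $ r"]) auto
  qed
  \<comment> \<open>Summability of real families is unconditional, hence absolute; this allows the
    triangle inequality for series.\<close>
  have g_abs: "(\<lambda>t. \<bar>g i t\<bar>) summable_on X" if "i < ?N" for i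
    using has_sum_imp_summable[OF g_sum[OF that]] summable_on_iff_abs_summable_on_real[of "g i" X]
    by simp
  have norm_g: "(\<Sum>i<?N. \<bar>g i t\<bar>) = l1_norm (B * ?C t *\<^sub>v c t)" for t
    using B by (simp add: g_def l1_norm_def)
  have "l1_norm (B *\<^sub>v y) = (\<Sum>i<?N. \<bar>(B *\<^sub>v y) $ i\<bar>)"
    using B by (simp add: l1_norm_def)
  also have "\<dots> = (\<Sum>i<?N. \<bar>infsum (g i) X\<bar>)"
    using infsumI[OF g_sum] by (intro sum.cong refl) (metis lessThan_iff)
  also have "\<dots> \<le> (\<Sum>i<?N. \<Sum>\<^sub>\<infinity>t\<in>X. \<bar>g i t\<bar>)"
    using norm_infsum_bound[of "g _" X] g_abs by (intro sum_mono) auto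
  \<comment> \<open>Regrouping by \<open>t\<close> reassembles the coordinates into an l1 norm, to
    which \<open>bound\<close> applies.\<close>
  also have "\<dots> = (\<Sum>\<^sub>\<infinity>t\<in>X. \<Sum>i<?N. \<bar>g i t\<bar>)"
    using g_abs by (intro infsum_finite_sum[symmetric]) auto
  also have "\<dots> \<le> (\<Sum>\<^sub>\<infinity>t\<in>X. \<beta> * l1_norm (c t))"
    using g_abs bound cc
    by (intro infsum_mono summable_on_finite_sum summable_on_cmult_right ell1_summable[OF c])
      (auto simp: norm_g)
  also have "\<dots> = \<beta> * ell1_norm X c"
    unfolding ell1_norm_def by (rule infsum_cmult_right')
  finally show ?thesis .
qed

end

section \<open>Equivalence of the inequality between minima and the operator norm bound\<close>

theorem theorem5p2:
  fixes X :: "'a set" and d m :: nat and K :: "'a \<Rightarrow> 'a \<Rightarrow> real mat"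
    and xs :: "'a list" and \<beta> :: real
  assumes "X \<noteq> {}" and "d \<ge> 1" and "admissible_kernel d X K"
    and "m \<ge> 1" and "length xs = m" and "distinct xs" and "set xs \<subseteq> X"
    and "\<beta> \<ge> 1"
    and "\<forall>y\<in>carrier_vec (m * d).
           \<exists>f. is_arg_min (B_norm d X K) (\<lambda>f. f \<in> interpolants d X K xs y) f"
  shows "(\<forall>y\<in>carrier_vec (m * d).
            min_B_norm d X K (interpolants d X K xs y)
              \<ge> 1 / \<beta> * min_B_norm d X K (interpolants d X K xs y \<inter> S_space d X K xs))
     \<longleftrightarrow> (SUP t\<in>X. ereal (op_norm1 (the (mat_inverse (kernel_mat d K xs)) * kernel_col d K xs t)))
           \<le> ereal \<beta>"
proof -
  interpret multi_task_kernel d X K by unfold_locales (rule assms)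
  define B where "B = the (mat_inverse (kernel_mat d K xs))"
  let ?N = "m * d" and ?C = "\<lambda>t. kernel_col d K xs t"
  note xs = \<open>distinct xs\<close> \<open>set xs \<subseteq> X\<close> and m = \<open>length xs = m\<close>
  have B: "B \<in> carrier_mat ?N ?N" using kernel_inverse(1)[OF xs] m by (simp add: B_def)
  have C: "?C t \<in> carrier_mat ?N d" for t using kernel_col_carrier[of d K xs t] unfolding m .
  have min_S: "min_B_norm d X K (interpolants d X K xs y \<inter> S_space d X K xs) = l1_norm (B *\<^sub>v y)"
    if "y \<in> carrier_vec ?N" for y
    using min_B_norm_S_space[OF xs] that m by (simp add: B_def)
  \<comment> \<open>The assumed minimizer makes the \<open>LEAST\<close> in
    \<open>min_B_norm\<close> an attained value; its coefficients then stand in for the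
    function.\<close>
  have least: "\<exists>c\<in>ell1 d X. kernel_sum d X K c \<in> interpolants d X K xs y \<and>
      min_B_norm d X K (interpolants d X K xs y) = ell1_norm X c \<and>
      (\<forall>f\<in>interpolants d X K xs y. ell1_norm X c \<le> B_norm d X K f)"
    if y: "y \<in> carrier_vec ?N" for y
  proof -
    obtain f where f: "f \<in> interpolants d X K xs y"
      and le: "\<And>f'. f' \<in> interpolants d X K xs y \<Longrightarrow> B_norm d X K f \<le> B_norm d X K f'"
      using assms(9) y by (auto simp: is_arg_min_linorder)
    obtain c where c: "c \<in> ell1 d X" "f = kernel_sum d X K c"
      using f by (auto simp: interpolants_def B_space_def)
    have "min_B_norm d X K (interpolants d X K xs y) = B_norm d X K f"
      unfolding min_B_norm_def using f le by (intro Least_equality) auto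
    moreover have "B_norm d X K f = ell1_norm X c" using c B_norm_kernel_sum by simp
    ultimately show ?thesis using c f le by (intro bexI[of _ c]) auto
  qed
  \<comment> \<open>A supremum in \<open>ereal\<close> always exists, so it is at most \<beta>
    exactly when each term is; \<open>\<beta> \<ge> 1\<close> gives the nonnegativity that
    \<open>op_norm1_le_iff\<close> demands.\<close>
  have bound_iff: "(SUP t\<in>X. ereal (op_norm1 (B * ?C t))) \<le> ereal \<beta> \<longleftrightarrow>
      (\<forall>t\<in>X. \<forall>v\<in>carrier_vec d. l1_norm (B * ?C t *\<^sub>v v) \<le> \<beta> * l1_norm v)"
    using op_norm1_le_iff[of "B * ?C _" ?N d \<beta>] B C \<open>\<beta> \<ge> 1\<close> by (simp add: SUP_le_iff)
  show ?thesis
    unfolding B_def[symmetric] bound_iff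
  proof (intro iffI ballI)
    fix t and v :: "real vec"
    assume le: "\<forall>y\<in>carrier_vec ?N. min_B_norm d X K (interpolants d X K xs y)
        \<ge> 1 / \<beta> * min_B_norm d X K (interpolants d X K xs y \<inter> S_space d X K xs)"
      and t: "t \<in> X" and v: "v \<in> carrier_vec d"
    have y: "?C t *\<^sub>v v \<in> carrier_vec ?N" using C[of t] v by auto
    \<comment> \<open>The one-point list realises K(t, .) v as an element of \<open>B_space\<close>,
      whether or not \<open>t\<close> is one of the interpolation points.\<close>
    let ?c = "point_family d X [t] (\<lambda>_. v)"
    have c: "?c \<in> ell1 d X" using t v by (intro point_family_ell1) auto
    have "kernel_sum d X K ?c s = K t s *\<^sub>v v" if "s \<in> X" for s
      using kernel_sum_point_family[of "[t]" "\<lambda>_. v"] t that kernel_carrier[OF t that]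
      by (intro eq_vecI) (auto simp: vec_infsum_def)
    moreover have "block d (?C t *\<^sub>v v) j = K t (xs ! j) *\<^sub>v v" if "j < length xs" for j
      using that v t xs by (intro block_kernel_col_mult kernel_carrier) auto
    ultimately have "kernel_sum d X K ?c \<in> interpolants d X K xs (?C t *\<^sub>v v)"
      using c xs(2)[THEN subsetD, OF nth_mem]
      by (auto simp: interpolants_def B_space_def block_def)
    then have "min_B_norm d X K (interpolants d X K xs (?C t *\<^sub>v v)) \<le> ell1_norm X ?c"
      using least[OF y] B_norm_kernel_sum[OF c] by fastforce
    also have "ell1_norm X ?c = l1_norm v"
      using t by (simp add: point_family_ell1_norm)
    finally have "1 / \<beta> * l1_norm (B *\<^sub>v (?C t *\<^sub>v v)) \<le> l1_norm v"
      using le[rule_format, OF y] min_S[OF y] by simp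
    then show "l1_norm (B * ?C t *\<^sub>v v) \<le> \<beta> * l1_norm v"
      using \<open>\<beta> \<ge> 1\<close> by (simp add: assoc_mult_mat_vec[OF B C v] field_simps)
  next
    fix y :: "real vec"
    assume bound: "\<forall>t\<in>X. \<forall>v\<in>carrier_vec d. l1_norm (B * ?C t *\<^sub>v v) \<le> \<beta> * l1_norm v"
      and y: "y \<in> carrier_vec ?N"
    obtain c where c: "c \<in> ell1 d X" "kernel_sum d X K c \<in> interpolants d X K xs y"
      and min: "min_B_norm d X K (interpolants d X K xs y) = ell1_norm X c"
      using least[OF y] by blast
    have "l1_norm (B *\<^sub>v y) \<le> \<beta> * ell1_norm X c"
      using l1_norm_inverse_interpolated_le[OF xs _ c, of \<beta>] bound y m by (simp add: B_def)
    then show "min_B_norm d X K (interpolants d X K xs y)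
        \<ge> 1 / \<beta> * min_B_norm d X K (interpolants d X K xs y \<inter> S_space d X K xs)"
      using \<open>\<beta> \<ge> 1\<close> by (simp add: min min_S[OF y] field_simps)
  qed
qed

end
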